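(* Let $(\mathcal M,d)$ be a Hadamard space with the geodesic extension property. Let $X\subset\mathcal M$ be nonempty, closed, bounded and geodesically convex, with diameter bounded above by $D>0$. Let $f\colon\mathcal M\to\mathbf R$ be globally Lipschitz with constant $L>0$, and suppose that for every $x\in\mathcal M$ the lower level set $f_x=\{z\in\mathcal M: f(z)\le f(x)\}$ is horospherically convex. Suppose that a support oracle for $f$ is available, and that the optimal value $f^*=\inf_X f$ is attained at some point $x^*\in X$. Let $n>0$ be an integer, and run the projected subgradient iteration with fixed step length $\epsilon=\frac{D}{\sqrt n}$ from an arbitrary initial point $x^1\in X$. If $n$ iterations are performed, generating the points $x^1,x^2,\dots,x^n,x^{n+1}\in X$, then the average of the function values at the iterates satisfies \[ \frac1n\sum_{i=1}^n f(x^i)\;-\;\min_X f\;\le\;\frac{LD}{\sqrt n}. \]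
   Context: A Hadamard space is a complete CAT(0) space. A ray is a unit-speed geodesic ray $r\colon\mathbf R_+\to\mathcal M$. The space $\mathcal M$ has the geodesic extension property if for every geodesic segment $[x,y]$ in $\mathcal M$ there is a ray $r$ with $r(0)=x$ and $r(t)=y$ for some $t\ge 0$. The Busemann function of a ray $r$ is $b_r(x)=\lim_{t\to\infty}\big(d(x,r(t))-t\big)$ for $x\in\mathcal M$. Given a closed set $F\subset\mathcal M$ and a point $x\in F$, a supporting ray for $F$ at $x$ is a ray $r$ with $r(0)=x$ and $F\subset\{z\in\mathcal M: b_r(z)\le 0\}$. A closed set $F\subset\mathcal M$ is horospherically convex if there is a supporting ray for $F$ at every boundary point $x$ of $F$. Projection: for $x\in\mathcal M$, $\mathrm{Proj}(x)$ denotes the (unique) nearest point to $x$ in $X$. Support oracle: for any input $x\in\mathcal M$ and any step length $\epsilon>0$, the oracle either responds that $x$ minimizes $f$ over $\mathcal M$ (a correct response), or outputs a point $x_\epsilon$ lying on some supporting ray for $f_x$ at $x$ and satisfying $d(x,x_\epsilon)=\epsilon$. Projected subgradient iteration with fixed step length $\epsilon>0$: starting from $x^1\in X$, at each iterate $x^i\in X$ call the support oracle at $x=x^i$ with step length $\epsilon$. If it responds that $x^i$ minimizes $f$ over $\mathcal M$, stop; otherwise, with $x_\epsilon$ the oracle's output, set $x^{i+1}=\mathrm{Proj}(x_\epsilon)$. *)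

theory Defs
  imports "HOL-Analysis.Analysis"
begin

definition geodesic_segment :: "'a::metric_space set \<Rightarrow> 'a \<Rightarrow> 'a \<Rightarrow> bool" where
  "geodesic_segment S x y \<longleftrightarrow>
     (\<exists>c::real \<Rightarrow> 'a. c 0 = x \<and> c (dist x y) = y \<and>
        (\<forall>s\<in>{0..dist x y}. \<forall>t\<in>{0..dist x y}. dist (c s) (c t) = \<bar>s - t\<bar>) \<and>
        S = c ` {0..dist x y})"

text \<open>Pairs of a point on the segment from \<open>x\<close> to \<open>y\<close> and its comparison point on the
  Euclidean segment from \<open>x'\<close> to \<open>y'\<close>, where \<open>dist x' y' = dist x y\<close>.\<close>

definition comparison_pairs ::
    "'a::metric_space set \<Rightarrow> 'a \<Rightarrow> real ^ 2 \<Rightarrow> real ^ 2 \<Rightarrow> ('a \<times> (real ^ 2)) set" where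
  "comparison_pairs S x x' y' =
     {(p, p'). p \<in> S \<and> p' \<in> closed_segment x' y' \<and> dist x' p' = dist x p}"

text \<open>CAT(0) in the sense of comparison triangles: any two points of a geodesic triangle, on
  the same side or on different sides, are at most as far apart as their comparison points.\<close>

class cat0_space = metric_space +
  assumes geodesic_segment_exists: "\<exists>S. geodesic_segment S x y"
    and cat0_inequality:
      "\<lbrakk>geodesic_segment A x y; geodesic_segment B y z; geodesic_segment C z x;
        dist x' y' = dist x y; dist y' z' = dist y z; dist z' x' = dist z x;
        (p, p') \<in> comparison_pairs A x x' y' \<union> comparison_pairs B y y' z' \<union> comparison_pairs C z z' x';
        (q, q') \<in> comparison_pairs A x x' y' \<union> comparison_pairs B y y' z' \<union> comparison_pairs C z z' x'\<rbrakk>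
       \<Longrightarrow> dist p q \<le> dist p' q'"

class hadamard_space = cat0_space + complete_space

definition geodesic_ray :: "(real \<Rightarrow> 'a::metric_space) \<Rightarrow> bool" where
  "geodesic_ray r \<longleftrightarrow> (\<forall>s\<ge>0. \<forall>t\<ge>0. dist (r s) (r t) = \<bar>s - t\<bar>)"

definition geodesic_extension_property :: "'a::metric_space itself \<Rightarrow> bool" where
  "geodesic_extension_property _ \<longleftrightarrow>
     (\<forall>S (x::'a) y. geodesic_segment S x y \<longrightarrow>
        (\<exists>r. geodesic_ray r \<and> r 0 = x \<and> (\<exists>t\<ge>0. r t = y)))"

definition geodesically_convex :: "'a::metric_space set \<Rightarrow> bool" where
  "geodesically_convex X \<longleftrightarrow>
     (\<forall>x\<in>X. \<forall>y\<in>X. \<forall>S. geodesic_segment S x y \<longrightarrow> S \<subseteq> X)"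

definition busemann :: "(real \<Rightarrow> 'a::metric_space) \<Rightarrow> 'a \<Rightarrow> real" where
  "busemann r x = Lim at_top (\<lambda>t. dist x (r t) - t)"

definition supporting_ray :: "(real \<Rightarrow> 'a::metric_space) \<Rightarrow> 'a set \<Rightarrow> 'a \<Rightarrow> bool" where
  "supporting_ray r F x \<longleftrightarrow> geodesic_ray r \<and> r 0 = x \<and> F \<subseteq> {z. busemann r z \<le> 0}"

definition horospherically_convex :: "'a::metric_space set \<Rightarrow> bool" where
  "horospherically_convex F \<longleftrightarrow>
     closed F \<and> (\<forall>x\<in>frontier F. \<exists>r. supporting_ray r F x)"

definition lower_level_set :: "('a \<Rightarrow> real) \<Rightarrow> 'a \<Rightarrow> 'a set" where
  "lower_level_set f x = {z. f z \<le> f x}"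

definition proj :: "'a::metric_space set \<Rightarrow> 'a \<Rightarrow> 'a" where
  "proj X x = (THE p. p \<in> X \<and> (\<forall>y\<in>X. dist x p \<le> dist x y))"

datatype 'a oracle_answer = Minimizer | Point 'a

text \<open>The oracle maps a query to the nonempty set of answers it may give, so it need not answer
  the same query always in the same way; a deterministic oracle has singleton values.\<close>

definition support_oracle ::
    "('a::metric_space \<Rightarrow> real) \<Rightarrow> ('a \<Rightarrow> real \<Rightarrow> 'a oracle_answer set) \<Rightarrow> bool" where
  "support_oracle f orc \<longleftrightarrow>
     (\<forall>x. \<forall>\<epsilon>>0. orc x \<epsilon> \<noteq> {} \<and>
        (Minimizer \<in> orc x \<epsilon> \<longrightarrow> (\<forall>z. f x \<le> f z)) \<and>
        (\<forall>y. Point y \<in> orc x \<epsilon> \<longrightarrow>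
           (\<exists>r. supporting_ray r (lower_level_set f x) x \<and> y \<in> r ` {0..}) \<and> dist x y = \<epsilon>))"

text \<open>The first \<open>n\<close> iterations are actually performed, that is, the method does not stop at any
  of \<open>x 1, ..., x n\<close>. Values of the sequence outside \<open>{1..n + 1}\<close> are irrelevant.\<close>

definition projected_subgradient_run ::
    "'a::metric_space set \<Rightarrow> ('a \<Rightarrow> real \<Rightarrow> 'a oracle_answer set) \<Rightarrow> real \<Rightarrow> nat \<Rightarrow>
       (nat \<Rightarrow> 'a) \<Rightarrow> bool" where
  "projected_subgradient_run X orc \<epsilon> n x \<longleftrightarrow>
     x 1 \<in> X \<and> (\<forall>i\<in>{1..n}. \<exists>y. Point y \<in> orc (x i) \<epsilon> \<and> x (i + 1) = proj X y)"

end

theory Submission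
  imports Defs
begin

text \<open>
  Fix an iterate \<open>w\<close> with supporting ray \<open>r\<close>, and write \<open>b\<close> for the Busemann function of \<open>r\<close>.
  Two facts make the classical analysis of the subgradient method work without tangent vectors,
  with the Busemann function in the role of a linear functional.

  The first is a quadratic bound. Along a ray, \<open>(dist z (r s))\<^sup>2 - s\<^sup>2\<close> is convex in \<open>s\<close> by the CAT(0)
  inequality, and its asymptotic slope is \<open>2 * b z\<close>; hence
  \<open>(dist z (r s))\<^sup>2 \<le> (dist z (r 0))\<^sup>2 + s\<^sup>2 + 2 * s * b z\<close> (\<open>dist_ray_power2_le\<close>).

  The second is a margin: if \<open>b \<le> 0\<close> on the ball of radius \<open>\<delta>\<close> about \<open>z\<close>, then \<open>b z \<le> - \<delta>\<close>
  (\<open>busemann_le_minus_radius\<close>). Here geodesic extension enters: one prolongs the geodesics from far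
  points \<open>r T\<close> to \<open>z\<close> by \<open>\<delta>\<close> beyond \<open>z\<close> and applies the quadratic bound at their ends.

  As \<open>f\<close> is Lipschitz, the level set of \<open>f\<close> at \<open>w\<close> contains the ball of radius
  \<open>\<delta> = (f w - f xstar) / L\<close> about \<open>xstar\<close>. So a step of length \<open>\<epsilon>\<close> along \<open>r\<close> changes the squared
  distance to \<open>xstar\<close> by at most \<open>\<epsilon>\<^sup>2 - 2 * \<epsilon> * \<delta>\<close>. Projecting back to \<open>X\<close> does not increase that
  distance (\<open>proj_pythagoras\<close>), so the bounds telescope over the iterations, and the choice
  \<open>\<epsilon> = D / sqrt n\<close> balances the two resulting terms.
\<close>

section \<open>Stewart's inequality in CAT(0) spaces\<close>

text \<open>The apex of the comparison triangle is found from the law of cosines; the triangle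
  inequalities say exactly that the square of its second coordinate is nonnegative.\<close>

lemma comparison_triangle_exists:
  fixes x y z :: "'a::metric_space"
  assumes "x \<noteq> y"
  obtains u v :: real
  where "u\<^sup>2 + v\<^sup>2 = (dist z x)\<^sup>2" "(u - dist x y)\<^sup>2 + v\<^sup>2 = (dist z y)\<^sup>2"
proof -
  define l a c where "l = dist x y" and "a = dist z x" and "c = dist z y"
  have l: "l > 0" and a: "a \<ge> 0" and c: "c \<ge> 0"
    using assms by (auto simp: l_def a_def c_def)
  have tri: "l \<le> a + c" "a \<le> l + c" "c \<le> a + l"
    unfolding l_def a_def c_def
    using dist_triangle[of x y z] dist_triangle[of z x y] dist_triangle[of z y x]
    by (simp_all add: dist_commute)
  define u where "u = (a\<^sup>2 + l\<^sup>2 - c\<^sup>2) / (2 * l)"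
  have u2: "2 * l * u = a\<^sup>2 + l\<^sup>2 - c\<^sup>2" using l by (simp add: u_def)
  have "2 * l * u \<le> 2 * l * a"
  proof -
    have "\<bar>a - l\<bar> \<le> \<bar>c\<bar>" using tri by linarith
    hence "(a - l)\<^sup>2 \<le> c\<^sup>2" by (simp only: abs_le_square_iff)
    thus ?thesis unfolding u2 by (simp add: power2_diff algebra_simps)
  qed
  hence "u \<le> a" using l by simp
  moreover have "2 * l * (- a) \<le> 2 * l * u"
  proof -
    have "c\<^sup>2 \<le> (a + l)\<^sup>2" using tri c by (intro power_mono) auto
    thus ?thesis unfolding u2 by (simp add: power2_sum algebra_simps)
  qed
  hence "- a \<le> u" using l by (simp only: mult_le_cancel_left_pos)
  ultimately have "u\<^sup>2 \<le> a\<^sup>2" using a by (simp add: abs_le_square_iff[symmetric])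
  hence v: "(sqrt (a\<^sup>2 - u\<^sup>2))\<^sup>2 = a\<^sup>2 - u\<^sup>2" by simp
  have "(u - l)\<^sup>2 + (a\<^sup>2 - u\<^sup>2) = c\<^sup>2" using u2 by (simp add: power2_diff algebra_simps)
  thus ?thesis using v by (intro that[of u "sqrt (a\<^sup>2 - u\<^sup>2)"]) (simp_all add: l_def a_def c_def)
qed

text \<open>This is Stewart's theorem in the comparison triangle, with the CAT(0) inequality applied to
  the vertex \<open>z\<close> and the point \<open>m\<close> of the opposite side.\<close>

lemma cat0_stewart:
  fixes x y z m :: "'a::cat0_space"
  assumes S: "geodesic_segment S x y" and m: "m \<in> S"
  shows "dist x y * (dist z m)\<^sup>2
    \<le> dist m y * (dist z x)\<^sup>2 + dist x m * (dist z y)\<^sup>2 - dist x m * dist m y * dist x y"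
proof -
  obtain c where c: "c 0 = x" "c (dist x y) = y"
    "\<forall>s\<in>{0..dist x y}. \<forall>t\<in>{0..dist x y}. dist (c s) (c t) = \<bar>s - t\<bar>" "S = c ` {0..dist x y}"
    using S unfolding geodesic_segment_def by blast
  define l where "l = dist x y"
  obtain s where s: "0 \<le> s" "s \<le> l" "m = c s" using m c(4) by (auto simp: l_def)
  have xm: "dist x m = s" using c(1) c(3)[rule_format, of 0 s] s by (simp add: l_def)
  have my: "dist m y = l - s" using c(2) c(3)[rule_format, of s l] s by (simp add: l_def)
  show ?thesis
  proof (cases "x = y")
    case True
    thus ?thesis using xm my s by (simp add: l_def)
  next
    case False
    hence l: "l > 0" by (simp add: l_def)
    obtain u v where uv: "u\<^sup>2 + v\<^sup>2 = (dist z x)\<^sup>2" "(u - l)\<^sup>2 + v\<^sup>2 = (dist z y)\<^sup>2"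
      using comparison_triangle_exists[OF False, of z] unfolding l_def by blast
    define x' y' z' m' :: "real ^ 2" where "x' = 0" and "y' = vector [l, 0]"
      and "z' = vector [u, v]" and "m' = vector [s, 0]"
    have norm2: "norm (w :: real ^ 2) = sqrt ((w $ 1)\<^sup>2 + (w $ 2)\<^sup>2)" for w
      by (simp add: norm_vec_def L2_set_def sum_2)
    note vec = x'_def y'_def z'_def m'_def dist_norm norm2
    have d: "dist x' y' = dist x y" "dist y' z' = dist y z" "dist z' x' = dist z x"
      using l uv by (simp_all add: vec dist_commute power2_commute[of l u]) (simp add: l_def)
    have xm': "dist x' m' = dist x m" using s xm by (simp add: vec)
    have "m' = (s / l) *\<^sub>R y'" using l by (simp add: vec vec_eq_iff forall_2)
    hence "m' \<in> closed_segment x' y'"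
      unfolding closed_segment_def x'_def using s l by (auto intro!: exI[of _ "s / l"])
    hence pm: "(m, m') \<in> comparison_pairs S x x' y'"
      using m xm' by (simp add: comparison_pairs_def)
    obtain B C where BC: "geodesic_segment B y z" "geodesic_segment C z x"
      using geodesic_segment_exists by meson
    obtain k where "k (dist y z) = z" "B = k ` {0..dist y z}"
      using BC(1) unfolding geodesic_segment_def by blast
    hence "z \<in> B" by (metis atLeastAtMost_iff imageI order_refl zero_le_dist)
    hence pz: "(z, z') \<in> comparison_pairs B y y' z'"
      using d by (simp add: comparison_pairs_def)
    have "dist z m \<le> dist z' m'"
      by (rule cat0_inequality[OF S BC d]) (use pm pz in auto)
    hence "(dist z m)\<^sup>2 \<le> (dist z' m')\<^sup>2" by (intro power_mono) auto
    also have "(dist z' m')\<^sup>2 = (u - s)\<^sup>2 + v\<^sup>2" by (simp add: vec)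
    finally have "l * (dist z m)\<^sup>2 \<le> l * ((u - s)\<^sup>2 + v\<^sup>2)" using l by simp
    also have "\<dots> = (l - s) * (u\<^sup>2 + v\<^sup>2) + s * ((u - l)\<^sup>2 + v\<^sup>2) - s * (l - s) * l"
      by (simp add: power2_eq_square algebra_simps)
    finally show ?thesis unfolding uv xm my by (simp add: l_def)
  qed
qed

text \<open>In the form used for projections, the point divides the segment in the ratio \<open>t : 1 - t\<close>.\<close>

lemma cat0_point_on_segment:
  fixes X :: "'a::cat0_space set"
  assumes "geodesically_convex X" "p \<in> X" "w \<in> X" "0 \<le> t" "t \<le> 1"
  obtains m where "m \<in> X"
    "\<And>y. (dist y m)\<^sup>2 \<le> (1 - t) * (dist y p)\<^sup>2 + t * (dist y w)\<^sup>2 - t * (1 - t) * (dist p w)\<^sup>2"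
proof (cases "p = w")
  case True
  thus ?thesis using that[of p] assms by (simp add: algebra_simps)
next
  case False
  define l where "l = dist p w"
  have l: "l > 0" using False by (simp add: l_def)
  obtain S where S: "geodesic_segment S p w" using geodesic_segment_exists by blast
  obtain c where c: "c 0 = p" "c l = w"
    "\<forall>s\<in>{0..l}. \<forall>t\<in>{0..l}. dist (c s) (c t) = \<bar>s - t\<bar>" "S = c ` {0..l}"
    using S unfolding geodesic_segment_def l_def by blast
  define s where "s = t * l"
  have s: "0 \<le> s" "s \<le> l" using assms(4,5) l by (auto simp: s_def mult_left_le_one_le)
  have pm: "dist p (c s) = s" using c(1) c(3)[rule_format, of 0 s] s by simp
  have mw: "dist (c s) w = l - s" using c(2) c(3)[rule_format, of s l] s by simp
  have cS: "c s \<in> S" using c(4) s by auto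
  show ?thesis
  proof (rule that[of "c s"])
    show "c s \<in> X" using assms(1-3) S cS unfolding geodesically_convex_def by blast
  next
    fix y
    have "l * (dist y (c s))\<^sup>2 \<le> (l - s) * (dist y p)\<^sup>2 + s * (dist y w)\<^sup>2 - s * (l - s) * l"
      using cat0_stewart[OF S cS, of y] by (simp add: pm mw l_def)
    also have "\<dots> = l * ((1 - t) * (dist y p)\<^sup>2 + t * (dist y w)\<^sup>2 - t * (1 - t) * l\<^sup>2)"
      by (simp add: s_def power2_eq_square algebra_simps)
    finally show "(dist y (c s))\<^sup>2
        \<le> (1 - t) * (dist y p)\<^sup>2 + t * (dist y w)\<^sup>2 - t * (1 - t) * (dist p w)\<^sup>2"
      using l by (simp add: l_def)
  qed
qed

section \<open>Projection onto a closed convex set\<close>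

text \<open>Minimality of \<open>p\<close> is tested against the points of the segment from \<open>p\<close> to \<open>w\<close> that tend
  to \<open>p\<close>: the first-order term of Stewart's inequality gives the claim.\<close>

lemma nearest_point_pythagoras:
  fixes X :: "'a::cat0_space set"
  assumes conv: "geodesically_convex X" and p: "p \<in> X" and near: "\<forall>w\<in>X. dist y p \<le> dist y w"
    and w: "w \<in> X"
  shows "(dist y p)\<^sup>2 + (dist p w)\<^sup>2 \<le> (dist y w)\<^sup>2"
proof -
  have bound: "(dist y p)\<^sup>2 + (1 - t) * (dist p w)\<^sup>2 \<le> (dist y w)\<^sup>2" if t: "0 < t" "t \<le> 1" for t
  proof -
    obtain m where m: "m \<in> X"
      "(dist y m)\<^sup>2 \<le> (1 - t) * (dist y p)\<^sup>2 + t * (dist y w)\<^sup>2 - t * (1 - t) * (dist p w)\<^sup>2"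
      using cat0_point_on_segment[OF conv p w, of t] t by auto
    have "(dist y p)\<^sup>2 \<le> (dist y m)\<^sup>2" using near m(1) by (intro power_mono) auto
    also note m(2)
    finally have "t * ((dist y p)\<^sup>2 + (1 - t) * (dist p w)\<^sup>2) \<le> t * (dist y w)\<^sup>2"
      by (simp add: algebra_simps)
    thus ?thesis using t by simp
  qed
  have "((\<lambda>t. (dist y p)\<^sup>2 + (1 - t) * (dist p w)\<^sup>2) \<longlongrightarrow> (dist y p)\<^sup>2 + (1 - 0) * (dist p w)\<^sup>2)
      (at_right 0)"
    by (intro tendsto_intros)
  moreover have "\<forall>\<^sub>F t in at_right 0. (dist y p)\<^sup>2 + (1 - t) * (dist p w)\<^sup>2 \<le> (dist y w)\<^sup>2"
    unfolding eventually_at_right_field using bound by (intro exI[of _ 1]) auto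
  ultimately have "(dist y p)\<^sup>2 + (1 - 0) * (dist p w)\<^sup>2 \<le> (dist y w)\<^sup>2"
    by (intro tendsto_upperbound) auto
  thus ?thesis by simp
qed

text \<open>A minimizing sequence is Cauchy: the midpoint of two almost nearest points would be too close
  to \<open>y\<close> if they were far apart.\<close>

lemma nearest_point_exists:
  fixes X :: "'a::hadamard_space set"
  assumes "X \<noteq> {}" "closed X" and conv: "geodesically_convex X"
  obtains p where "p \<in> X" "\<forall>w\<in>X. dist y p \<le> dist y w"
proof -
  define d where "d = infdist y X"
  have d: "d \<ge> 0" "\<And>w. w \<in> X \<Longrightarrow> d \<le> dist y w"
    by (auto simp: d_def infdist_nonneg infdist_le)
  have "\<exists>w\<in>X. dist y w < d + 1 / real (Suc k)" for k
  proof -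
    have "(INF a\<in>X. dist y a) < d + 1 / real (Suc k)"
      unfolding d_def infdist_def using assms(1) by simp
    thus ?thesis by (subst (asm) cINF_less_iff) (use assms(1) in \<open>auto intro!: bdd_belowI[of _ 0]\<close>)
  qed
  then obtain w where w: "\<And>k. w k \<in> X" "\<And>k. dist y (w k) < d + 1 / real (Suc k)" by metis
  have "(\<lambda>k. d + 1 / real (Suc k)) \<longlonglongrightarrow> d + 0"
    by (intro tendsto_intros) (use LIMSEQ_inverse_real_of_nat in \<open>simp add: inverse_eq_divide\<close>)
  hence lim: "(\<lambda>k. dist y (w k)) \<longlonglongrightarrow> d"
    by (intro tendsto_sandwich[of "\<lambda>_. d" "\<lambda>k. dist y (w k)" sequentially "\<lambda>k. d + 1 / real (Suc k)"])
      (use w d in \<open>auto intro!: always_eventually less_imp_le simp del: of_nat_Suc\<close>)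
  hence lim2: "(\<lambda>k. (dist y (w k))\<^sup>2) \<longlonglongrightarrow> d\<^sup>2" by (intro tendsto_intros)
  have "Cauchy w"
  proof (rule metric_CauchyI)
    fix e :: real assume e: "e > 0"
    have "\<forall>\<^sub>F k in sequentially. (dist y (w k))\<^sup>2 < d\<^sup>2 + e\<^sup>2 / 4"
      using e by (intro order_tendstoD(2)[OF lim2]) auto
    then obtain N where N: "\<And>k. k \<ge> N \<Longrightarrow> (dist y (w k))\<^sup>2 < d\<^sup>2 + e\<^sup>2 / 4"
      by (auto simp: eventually_sequentially)
    have "dist (w i) (w j) < e" if ij: "i \<ge> N" "j \<ge> N" for i j
    proof -
      obtain m where m: "m \<in> X" "(dist y m)\<^sup>2 \<le> (1 - 1/2) * (dist y (w i))\<^sup>2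
          + 1/2 * (dist y (w j))\<^sup>2 - 1/2 * (1 - 1/2) * (dist (w i) (w j))\<^sup>2"
        using cat0_point_on_segment[OF conv w(1)[of i] w(1)[of j], of "1/2"] by auto
      have "d\<^sup>2 \<le> (dist y m)\<^sup>2" using d m(1) by (intro power_mono) auto
      hence "(dist (w i) (w j))\<^sup>2 < e\<^sup>2" using m(2) N[OF ij(1)] N[OF ij(2)] by simp
      thus ?thesis using e by (simp add: power2_less_imp_less)
    qed
    thus "\<exists>N. \<forall>i\<ge>N. \<forall>j\<ge>N. dist (w i) (w j) < e" by blast
  qed
  then obtain p where p: "w \<longlonglongrightarrow> p" using Cauchy_convergent convergent_def by blast
  have "p \<in> X" using closed_sequentially[OF assms(2)] w(1) p by blast
  moreover have "dist y p = d"
    using LIMSEQ_unique[OF tendsto_dist[OF tendsto_const p] lim] .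
  ultimately show ?thesis using that d by auto
qed

lemma proj_nearest:
  fixes X :: "'a::hadamard_space set"
  assumes "X \<noteq> {}" "closed X" "geodesically_convex X"
  shows "proj X y \<in> X \<and> (\<forall>w\<in>X. dist y (proj X y) \<le> dist y w)"
proof -
  obtain p where p: "p \<in> X" "\<forall>w\<in>X. dist y p \<le> dist y w"
    using nearest_point_exists[OF assms] by blast
  show ?thesis unfolding proj_def
  proof (rule theI[of _ p])
    fix q assume q: "q \<in> X \<and> (\<forall>w\<in>X. dist y q \<le> dist y w)"
    have "dist y p = dist y q" using p q by (meson order_antisym)
    thus "q = p" using nearest_point_pythagoras[OF assms(3) p, of q] q by simp
  qed (use p in auto)
qed

lemma proj_pythagoras:
  fixes X :: "'a::hadamard_space set"
  assumes "closed X" "geodesically_convex X" "w \<in> X"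
  shows "(dist y (proj X y))\<^sup>2 + (dist (proj X y) w)\<^sup>2 \<le> (dist y w)\<^sup>2"
  using proj_nearest[of X y] nearest_point_pythagoras[of X "proj X y" y w] assms by blast

section \<open>Busemann functions\<close>

lemma geodesic_rayD:
  "geodesic_ray r \<Longrightarrow> 0 \<le> s \<Longrightarrow> 0 \<le> t \<Longrightarrow> dist (r s) (r t) = \<bar>s - t\<bar>"
  by (simp add: geodesic_ray_def)

text \<open>The limit exists because \<open>dist z (r t) - t\<close> is nonincreasing in \<open>t\<close> and bounded below.\<close>

lemma busemann_tendsto:
  fixes z :: "'a::metric_space"
  assumes r: "geodesic_ray r"
  shows "((\<lambda>t. dist z (r t) - t) \<longlongrightarrow> busemann r z) at_top"
proof -
  define \<beta> where "\<beta> t = dist z (r t) - t" for t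
  have mono: "\<beta> t \<le> \<beta> s" if "0 \<le> s" "s \<le> t" for s t
    using dist_triangle[of z "r t" "r s"] geodesic_rayD[OF r, of s t] that by (simp add: \<beta>_def)
  have bdd: "bdd_below (\<beta> ` {0..})"
  proof (rule bdd_belowI2)
    fix t :: real assume "t \<in> {0..}"
    thus "- dist z (r 0) \<le> \<beta> t"
      using dist_triangle[of "r 0" "r t" z] geodesic_rayD[OF r, of 0 t]
      by (simp add: \<beta>_def dist_commute)
  qed
  have "(\<beta> \<longlongrightarrow> (INF t\<in>{0..}. \<beta> t)) at_top"
  proof (rule decreasing_tendsto)
    show "\<forall>\<^sub>F t in at_top. (INF t\<in>{0..}. \<beta> t) \<le> \<beta> t"
      using eventually_ge_at_top[of 0] by eventually_elim (auto intro!: cINF_lower bdd)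
  next
    fix a assume "(INF t\<in>{0..}. \<beta> t) < a"
    then obtain s where s: "s \<ge> 0" "\<beta> s < a" by (subst (asm) cINF_less_iff) (use bdd in auto)
    show "\<forall>\<^sub>F t in at_top. \<beta> t < a"
      using eventually_ge_at_top[of s] by eventually_elim (use mono s in force)
  qed
  hence "(\<beta> \<longlongrightarrow> Lim at_top \<beta>) at_top" using tendsto_Lim[of at_top \<beta>] by simp
  thus ?thesis unfolding busemann_def \<beta>_def .
qed

lemma ray_segment:
  assumes r: "geodesic_ray r" and t: "0 \<le> t"
  shows "geodesic_segment (r ` {0..t}) (r 0) (r t)"
proof -
  have "dist (r 0) (r t) = t" using geodesic_rayD[OF r, of 0 t] t by simp
  thus ?thesis unfolding geodesic_segment_def
    by (intro exI[of _ r]) (use geodesic_rayD[OF r] in auto)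
qed

text \<open>Stewart's inequality for \<open>z\<close> and the segment from \<open>r 0\<close> to \<open>r t\<close>, in the limit
  \<open>t \<rightarrow> \<infinity>\<close>; the Busemann function arises since \<open>((dist z (r t))\<^sup>2 - t\<^sup>2) / t\<close> tends to
  \<open>2 * busemann r z\<close>. Equality holds in Euclidean space.\<close>

lemma dist_ray_power2_le:
  fixes z :: "'a::cat0_space"
  assumes r: "geodesic_ray r" and s: "0 \<le> s"
  shows "(dist z (r s))\<^sup>2 \<le> (dist z (r 0))\<^sup>2 + s\<^sup>2 + 2 * s * busemann r z"
proof -
  define a where "a = dist z (r 0)"
  define \<beta> where "\<beta> t = dist z (r t) - t" for t
  have \<beta>: "(\<beta> \<longlongrightarrow> busemann r z) at_top"
    using busemann_tendsto[OF r, of z] by (simp add: \<beta>_def[abs_def])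
  have inv: "((\<lambda>t::real. inverse t) \<longlongrightarrow> 0) at_top"
    by (rule tendsto_inverse_0_at_top[OF filterlim_ident])
  define g where
    "g t = (1 - s * inverse t) * a\<^sup>2 + s * (2 * \<beta> t + (\<beta> t)\<^sup>2 * inverse t) + s\<^sup>2" for t
  have "(g \<longlongrightarrow> (1 - s * 0) * a\<^sup>2 + s * (2 * busemann r z + (busemann r z)\<^sup>2 * 0) + s\<^sup>2) at_top"
    unfolding g_def by (intro tendsto_intros \<beta> inv)
  moreover have "\<forall>\<^sub>F t in at_top. (dist z (r s))\<^sup>2 \<le> g t"
    using eventually_gt_at_top[of s]
  proof eventually_elim
    case (elim t)
    hence t: "t > 0" using s by simp
    have d: "dist (r 0) (r t) = t" "dist (r 0) (r s) = s" "dist (r s) (r t) = t - s"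
      using geodesic_rayD[OF r] s elim by auto
    have "t * (dist z (r s))\<^sup>2 \<le> (t - s) * a\<^sup>2 + s * (dist z (r t))\<^sup>2 - s * (t - s) * t"
      using cat0_stewart[OF ray_segment[OF r, of t], of "r s" z] s elim
      by (simp add: d a_def)
    also have "dist z (r t) = t + \<beta> t" by (simp add: \<beta>_def)
    also have "(t - s) * a\<^sup>2 + s * (t + \<beta> t)\<^sup>2 - s * (t - s) * t = t * g t"
      using t by (simp add: g_def field_simps power2_eq_square)
    finally show ?case using t by simp
  qed
  ultimately have "(dist z (r s))\<^sup>2
      \<le> (1 - s * 0) * a\<^sup>2 + s * (2 * busemann r z + (busemann r z)\<^sup>2 * 0) + s\<^sup>2"
    by (intro tendsto_lowerbound) auto
  thus ?thesis by (simp add: a_def algebra_simps)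
qed

lemma geodesic_extension_beyond:
  fixes p z :: "'a::cat0_space"
  assumes ext: "geodesic_extension_property TYPE('a)" and "\<delta> \<ge> 0"
  obtains w where "dist z w = \<delta>" "dist p w = dist p z + \<delta>"
proof -
  obtain S where S: "geodesic_segment S p z" using geodesic_segment_exists by blast
  obtain q where q: "geodesic_ray q" "q 0 = p" "\<exists>t\<ge>0. q t = z"
    using ext[unfolded geodesic_extension_property_def, rule_format, OF S] by blast
  then obtain t where t: "t \<ge> 0" "q t = z" by blast
  show ?thesis
    by (rule that[of "q (t + \<delta>)"])
      (use geodesic_rayD[OF q(1), of t "t + \<delta>"] geodesic_rayD[OF q(1), of 0 "t + \<delta>"]
        geodesic_rayD[OF q(1), of 0 t] q(2) t assms(2) in auto)
qed

text \<open>The Busemann function grows at unit rate in the direction away from the far end of the ray,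
  so its value at \<open>z\<close> should be \<open>\<delta>\<close> below its supremum over the ball. A point that nearly attains
  this supremum is found by prolonging the geodesic from \<open>r T\<close> to \<open>z\<close> by \<open>\<delta>\<close>: the quadratic
  bound at the end gives \<open>(dist z (r T) + \<delta>)\<^sup>2 \<le> T\<^sup>2 + O(1)\<close>, whence
  \<open>dist z (r T) - T \<le> - \<delta> + O(1 / T)\<close>.\<close>

lemma busemann_le_minus_radius:
  fixes z :: "'a::cat0_space"
  assumes ext: "geodesic_extension_property TYPE('a)" and r: "geodesic_ray r"
    and \<delta>: "\<delta> \<ge> 0" and ball: "\<And>w. dist z w = \<delta> \<Longrightarrow> busemann r w \<le> 0"
  shows "busemann r z \<le> - \<delta>"
proof -
  define A where "A = dist z (r 0) + \<delta>"
  have bound: "dist z (r T) - T \<le> A\<^sup>2 / 2 * inverse T - \<delta>" if T: "T > 0" for T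
  proof -
    define \<beta> where "\<beta> = dist z (r T) - T"
    obtain w where w: "dist z w = \<delta>" "dist (r T) w = dist (r T) z + \<delta>"
      using geodesic_extension_beyond[OF ext \<delta>, of z "r T"] by blast
    have "dist w (r 0) \<le> A"
      using dist_triangle[of w "r 0" z] w(1) by (simp add: A_def dist_commute)
    hence A: "(dist w (r 0))\<^sup>2 \<le> A\<^sup>2" by (intro power_mono) auto
    have "T * busemann r w \<le> 0" using T ball[OF w(1)] by (simp add: mult_nonneg_nonpos)
    hence "(dist w (r T))\<^sup>2 \<le> A\<^sup>2 + T\<^sup>2"
      using dist_ray_power2_le[OF r, of T w] A T by simp
    moreover have "dist w (r T) = T + (\<beta> + \<delta>)"
      using w(2) by (simp add: \<beta>_def dist_commute)
    ultimately have "T\<^sup>2 + 2 * T * (\<beta> + \<delta>) + (\<beta> + \<delta>)\<^sup>2 \<le> A\<^sup>2 + T\<^sup>2"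
      by (simp add: power2_sum)
    hence "2 * T * (\<beta> + \<delta>) \<le> A\<^sup>2" using zero_le_power2[of "\<beta> + \<delta>"] by linarith
    thus ?thesis using T by (simp add: \<beta>_def field_simps)
  qed
  have "((\<lambda>T. A\<^sup>2 / 2 * inverse T - \<delta>) \<longlongrightarrow> A\<^sup>2 / 2 * 0 - \<delta>) at_top"
    by (intro tendsto_intros tendsto_inverse_0_at_top filterlim_ident)
  moreover have "\<forall>\<^sub>F T in at_top. dist z (r T) - T \<le> A\<^sup>2 / 2 * inverse T - \<delta>"
    using eventually_gt_at_top[of 0] by eventually_elim (rule bound)
  ultimately have "busemann r z \<le> A\<^sup>2 / 2 * 0 - \<delta>"
    by (intro tendsto_le[OF _ _ busemann_tendsto[OF r]]) auto
  thus ?thesis by simp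
qed

section \<open>The projected subgradient method\<close>

text \<open>By the Lipschitz condition, \<open>f\<close> stays below \<open>f w\<close> on the ball of radius \<open>(f w - f z) / L\<close>
  about \<open>z\<close>, so the Busemann function of the supporting ray at \<open>z\<close> is at most minus this radius.\<close>

lemma supporting_ray_step:
  fixes z w :: "'a::cat0_space" and f :: "'a \<Rightarrow> real"
  assumes ext: "geodesic_extension_property TYPE('a)"
    and L: "L > 0" "L-lipschitz_on UNIV f" and le: "f z \<le> f w"
    and r: "supporting_ray r (lower_level_set f w) w" and y: "y \<in> r ` {0..}"
  shows "(dist y z)\<^sup>2 \<le> (dist w z)\<^sup>2 + (dist w y)\<^sup>2 - 2 * dist w y * ((f w - f z) / L)"
proof -
  have ray: "geodesic_ray r" "r 0 = w"
    and sup: "\<And>v. f v \<le> f w \<Longrightarrow> busemann r v \<le> 0"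
    using r by (auto simp: supporting_ray_def lower_level_set_def)
  obtain s where s: "s \<ge> 0" "y = r s" using y by auto
  have ws: "dist w y = s" using geodesic_rayD[OF ray(1), of 0 s] ray(2) s by simp
  have "busemann r z \<le> - ((f w - f z) / L)"
  proof (rule busemann_le_minus_radius[OF ext ray(1)])
    fix v assume v: "dist z v = (f w - f z) / L"
    have "dist (f z) (f v) \<le> L * dist z v" using lipschitz_onD[OF L(2)] by simp
    thus "busemann r v \<le> 0" using v L(1) by (intro sup) (auto simp: dist_real_def)
  qed (use L le in simp)
  hence "2 * s * busemann r z \<le> 2 * s * - ((f w - f z) / L)"
    using s by (intro mult_left_mono) auto
  thus ?thesis
    using dist_ray_power2_le[OF ray(1) s(1), of z] ray(2) s(2)
    unfolding ws by (simp add: dist_commute[of _ z])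
qed

theorem theorem6p2:
  fixes X :: "'a::hadamard_space set"
    and f :: "'a \<Rightarrow> real"
    and orc :: "'a \<Rightarrow> real \<Rightarrow> 'a oracle_answer set"
    and x :: "nat \<Rightarrow> 'a"
    and xstar :: 'a
    and L D :: real
    and n :: nat
  assumes "geodesic_extension_property TYPE('a)"
    and "X \<noteq> {}" and "closed X" and "bounded X" and "geodesically_convex X"
    and "D > 0" and "diameter X \<le> D"
    and "L > 0" and "L-lipschitz_on UNIV f"
    and "\<And>z. horospherically_convex (lower_level_set f z)"
    and "support_oracle f orc"
    and "xstar \<in> X" and "f xstar = (INF z\<in>X. f z)"
    and "n > 0"
    and "projected_subgradient_run X orc (D / sqrt (real n)) n x"
  shows "(1 / real n) * (\<Sum>i=1..n. f (x i)) - (INF z\<in>X. f z) \<le> L * D / sqrt (real n)"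
proof -
  define \<epsilon> where "\<epsilon> = D / sqrt (real n)"
  have \<epsilon>: "\<epsilon> > 0" using assms(6,14) by (simp add: \<epsilon>_def)
  have dist_le: "dist v w \<le> D" if "v \<in> X" "w \<in> X" for v w
    using diameter_bounded_bound[OF assms(4) that] assms(7) by linarith
  \<comment> \<open>An infimum of reals is a lower bound only if the set is bounded below.\<close>
  have "bdd_below (f ` X)"
  proof (rule bdd_belowI2)
    fix v assume v: "v \<in> X"
    have "dist (f xstar) (f v) \<le> L * dist xstar v" using lipschitz_onD[OF assms(9)] by simp
    also have "\<dots> \<le> L * D" using dist_le[OF assms(12) v] assms(8) by simp
    finally show "f xstar - L * D \<le> f v" by (simp add: dist_real_def)
  qed
  hence opt: "f xstar \<le> f v" if "v \<in> X" for v
    unfolding assms(13) using that by (rule cINF_lower)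
  have run: "x 1 \<in> X" "\<And>i. i \<in> {1..n} \<Longrightarrow> \<exists>y. Point y \<in> orc (x i) \<epsilon> \<and> x (i + 1) = proj X y"
    using assms(15) unfolding projected_subgradient_run_def \<epsilon>_def by blast+
  have xX: "x i \<in> X" if "1 \<le> i" "i \<le> n" for i
  proof (cases "i = 1")
    case False
    hence "i - 1 \<in> {1..n}" using that by auto
    then obtain y where "x (i - 1 + 1) = proj X y" using run(2) by blast
    thus ?thesis using proj_nearest[OF assms(2,3,5)] that by simp
  qed (use run in simp)
  define \<delta> where "\<delta> i = (f (x i) - f xstar) / L" for i
  have step: "2 * \<epsilon> * \<delta> i \<le> (dist (x i) xstar)\<^sup>2 - (dist (x (i + 1)) xstar)\<^sup>2 + \<epsilon>\<^sup>2"
    if i: "1 \<le> i" "i \<le> n" for i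
  proof -
    obtain y where y: "Point y \<in> orc (x i) \<epsilon>" "x (i + 1) = proj X y" using run(2) i by auto
    obtain r where r: "supporting_ray r (lower_level_set f (x i)) (x i)" "y \<in> r ` {0..}"
      and d: "dist (x i) y = \<epsilon>"
      using assms(11) \<epsilon> y(1) unfolding support_oracle_def by blast
    have "(dist y xstar)\<^sup>2 \<le> (dist (x i) xstar)\<^sup>2 + \<epsilon>\<^sup>2 - 2 * \<epsilon> * \<delta> i"
      using supporting_ray_step[OF assms(1,8,9) opt[OF xX[OF i]] r] by (simp add: d \<delta>_def)
    moreover have "(dist (x (i + 1)) xstar)\<^sup>2 \<le> (dist y xstar)\<^sup>2"
      using proj_pythagoras[OF assms(3,5,12), of y] zero_le_power2[of "dist y (proj X y)"]
      by (simp only: y(2))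
    ultimately show ?thesis by linarith
  qed
  have "2 * \<epsilon> * (\<Sum>i=1..n. \<delta> i)
      \<le> (\<Sum>i=1..n. (dist (x i) xstar)\<^sup>2 - (dist (x (i + 1)) xstar)\<^sup>2 + \<epsilon>\<^sup>2)"
    unfolding sum_distrib_left by (intro sum_mono step) auto
  also have "\<dots> = (\<Sum>i=1..n. (dist (x i) xstar)\<^sup>2 - (dist (x (Suc i)) xstar)\<^sup>2) + real n * \<epsilon>\<^sup>2"
    by (simp add: sum.distrib)
  also have "\<dots> = (dist (x 1) xstar)\<^sup>2 - (dist (x (Suc n)) xstar)\<^sup>2 + real n * \<epsilon>\<^sup>2"
    using assms(14) sum_Suc_diff[of 1 n "\<lambda>i. - (dist (x i) xstar)\<^sup>2"] by simp
  also have "\<dots> \<le> D\<^sup>2 + real n * \<epsilon>\<^sup>2"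
    using power_mono[OF dist_le[OF run(1) assms(12)] zero_le_dist, of 2]
      zero_le_power2[of "dist (x (Suc n)) xstar"] by linarith
  also have "\<dots> = 2 * \<epsilon> * (real n * \<epsilon>)"
    using assms(14) by (simp add: \<epsilon>_def power_divide field_simps power2_eq_square)
  finally have sum: "(\<Sum>i=1..n. \<delta> i) \<le> real n * \<epsilon>" using \<epsilon> by simp
  have "(1 / real n) * (\<Sum>i=1..n. f (x i)) - f xstar = L / real n * (\<Sum>i=1..n. \<delta> i)"
    using assms(8,14)
    by (simp add: \<delta>_def sum_divide_distrib[symmetric] sum_subtractf field_simps)
  also have "\<dots> \<le> L / real n * (real n * \<epsilon>)"
    using sum assms(8) by (intro mult_left_mono) auto
  also have "\<dots> = L * D / sqrt (real n)" using assms(14) by (simp add: \<epsilon>_def)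
  finally show ?thesis by (simp only: assms(13))
qed

end
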